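(* Let $P=(X,\prec)$ be a poset with $|X|=n$ elements. Then for every integer $t\ge 2$, $$\Omega(P,t)^2\ \geq\ \Big(1+\frac{1}{(t+1)^{n+1}}\Big)\,\Omega(P,t+1)\,\Omega(P,t-1).$$ In particular $\Omega(P,t)^2>\Omega(P,t+1)\,\Omega(P,t-1)$.
   Context: $\Omega(P,t)$ is the number of maps $g:X\to[t]=\{1,\dots,t\}$ with $g(x)\le g(y)$ whenever $x\prec y$.
   Formalization: The poset is assumed nonempty (n ≥ 1): for the empty poset every Ω(P,t) equals 1, so both displayed inequalities fail (1 ≥ 1 + 1/(t+1) and 1 > 1). *)

theory Defs
  imports Complex_Main "HOL-Library.FuncSet"
begin

text \<open>
  A poset is given by a carrier \<open>X\<close> and its \<^emph>\<open>strict\<close> order \<open>prec\<close>; the values of \<open>prec\<close>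
  outside \<open>X\<close> are irrelevant.
\<close>

definition strict_poset_on :: "'a set \<Rightarrow> ('a \<Rightarrow> 'a \<Rightarrow> bool) \<Rightarrow> bool" where
  "strict_poset_on X prec \<longleftrightarrow> irreflp_on X prec \<and> transp_on X prec"

text \<open>
  The extensional function space makes maps on \<open>X\<close> correspond one-to-one to its members, so the
  cardinality counts each map exactly once.
\<close>

definition order_poly :: "'a set \<Rightarrow> ('a \<Rightarrow> 'a \<Rightarrow> bool) \<Rightarrow> nat \<Rightarrow> nat" where
  "order_poly X prec t = card {g \<in> X \<rightarrow>\<^sub>E {1..t}. monotone_on X prec (\<le>) g}"

end

theory Submission
  imports Defs
begin

text \<open>
  Replacing the range \<open>{1..t-1}\<close> by \<open>{2..t}\<close>, consider pairs of order preserving maps \<open>g\<close> into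
  \<open>{1..t+1}\<close> and \<open>h\<close> into \<open>{2..t}\<close>. Link \<open>x \<prec> y\<close> when exchanging the values of \<open>g\<close> and \<open>h\<close> at
  only one of them would break monotonicity, i.e. when \<open>max (g x) (h x) > min (g y) (h y)\<close>.
  Exchange \<open>g\<close> and \<open>h\<close> on all components of this relation that meet \<open>{x. g x = t+1}\<close>. The sign of
  \<open>g - h\<close> is constant along links, so \<open>g > h \<ge> 2\<close> on the exchanged part, and the result is a pair
  of maps into \<open>{1..t}\<close> and \<open>{2..t+1}\<close>. The exchanged part depends only on \<open>max g h\<close> and
  \<open>min g h\<close>, so the exchange can be undone. Pairs with \<open>g x = 1\<close> and \<open>h x = t+1\<close> are never reached;
  for minimal \<open>x\<close> there are at least \<open>\<Omega>(P,t) / t\<close> of them.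
\<close>

section \<open>Order preserving maps into a range of values\<close>

definition order_maps :: "'a set \<Rightarrow> ('a \<Rightarrow> 'a \<Rightarrow> bool) \<Rightarrow> nat set \<Rightarrow> ('a \<Rightarrow> nat) set" where
  "order_maps X prec I = {g \<in> X \<rightarrow>\<^sub>E I. monotone_on X prec (\<le>) g}"

lemma order_poly_eq_card_order_maps: "order_poly X prec t = card (order_maps X prec {1..t})"
  by (simp add: order_poly_def order_maps_def)

lemma order_mapsI:
  assumes "\<And>x. x \<in> X \<Longrightarrow> g x \<in> I" and "\<And>x. x \<notin> X \<Longrightarrow> g x = undefined"
    and "\<And>x y. x \<in> X \<Longrightarrow> y \<in> X \<Longrightarrow> prec x y \<Longrightarrow> g x \<le> g y"
  shows "g \<in> order_maps X prec I"
  using assms by (auto simp: order_maps_def monotone_on_def intro!: PiE_I)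

lemma order_mapsD:
  assumes "g \<in> order_maps X prec I"
  shows "x \<in> X \<Longrightarrow> g x \<in> I" and "x \<notin> X \<Longrightarrow> g x = undefined"
    and "x \<in> X \<Longrightarrow> y \<in> X \<Longrightarrow> prec x y \<Longrightarrow> g x \<le> g y"
  using assms by (auto simp: order_maps_def monotone_on_def PiE_iff extensional_def)

lemma finite_order_maps: "finite X \<Longrightarrow> finite I \<Longrightarrow> finite (order_maps X prec I)"
  by (simp add: order_maps_def finite_PiE)

lemma order_maps_mono: "I \<subseteq> J \<Longrightarrow> order_maps X prec I \<subseteq> order_maps X prec J"
  by (auto simp: order_maps_def PiE_iff)

lemma const_in_order_maps: "c \<in> I \<Longrightarrow> (\<lambda>x\<in>X. c) \<in> order_maps X prec I"
  by (rule order_mapsI) auto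

lemma card_order_maps_le:
  assumes "finite X" and "finite I"
  shows "card (order_maps X prec I) \<le> card I ^ card X"
proof -
  have "card (order_maps X prec I) \<le> card (X \<rightarrow>\<^sub>E I)"
    using assms by (intro card_mono finite_PiE) (auto simp: order_maps_def)
  then show ?thesis
    using assms by (simp add: card_PiE)
qed

text \<open>Raising all values by one is a bijection. This turns the ranges \<open>{2..t}\<close>
  and \<open>{2..t+1}\<close> of the exchange argument back into initial intervals.\<close>

lemma card_order_maps_Suc: "card (order_maps X prec {Suc a..Suc b}) = card (order_maps X prec {a..b})"
proof -
  let ?f = "\<lambda>g. \<lambda>x\<in>X. Suc (g x)" and ?k = "\<lambda>g. \<lambda>x\<in>X. g x - (1::nat)"
  have "bij_betw ?f (order_maps X prec {a..b}) (order_maps X prec {Suc a..Suc b})"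
  proof (rule bij_betw_byWitness[where f' = ?k])
    show "\<forall>g\<in>order_maps X prec {a..b}. ?k (?f g) = g"
      by (auto simp: fun_eq_iff order_mapsD(2))
    \<comment> \<open>All values are at least \<open>Suc a\<close>, so the truncated subtraction
      loses nothing.\<close>
    have "Suc (g x - 1) = g x" if "g \<in> order_maps X prec {Suc a..Suc b}" "x \<in> X" for g x
      using order_mapsD(1)[OF that] by auto
    then show "\<forall>g\<in>order_maps X prec {Suc a..Suc b}. ?f (?k g) = g"
      by (auto simp: fun_eq_iff order_mapsD(2))
    show "?f ` order_maps X prec {a..b} \<subseteq> order_maps X prec {Suc a..Suc b}"
      by (auto intro!: order_mapsI dest: order_mapsD)
    show "?k ` order_maps X prec {Suc a..Suc b} \<subseteq> order_maps X prec {a..b}"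
    proof (rule image_subsetI)
      fix g assume g: "g \<in> order_maps X prec {Suc a..Suc b}"
      show "?k g \<in> order_maps X prec {a..b}"
        using order_mapsD(1)[OF g] order_mapsD(3)[OF g]
        by (intro order_mapsI) (fastforce simp: diff_le_mono)+
    qed
  qed
  then show ?thesis
    by (metis bij_betw_same_card)
qed

text \<open>Nothing lies below \<open>x\<close>, so lowering the value there to \<open>c\<close>
  keeps a map monotone. The old value \<open>g x\<close> together with the lowered map determines
  \<open>g\<close>.\<close>

lemma card_order_maps_le_minimal:
  assumes "finite X" and "finite I" and "x \<in> X" and min: "\<And>y. y \<in> X \<Longrightarrow> \<not> prec y x"
    and least: "c \<in> I" "\<And>i. i \<in> I \<Longrightarrow> c \<le> i"
  shows "card (order_maps X prec I) \<le> card I * card {g \<in> order_maps X prec I. g x = c}"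
proof -
  let ?A = "{g \<in> order_maps X prec I. g x = c}"
  have "card (order_maps X prec I) \<le> card (I \<times> ?A)"
  proof (rule card_inj_on_le[where f = "\<lambda>g. (g x, g(x := c))"])
    show "inj_on (\<lambda>g. (g x, g(x := c))) (order_maps X prec I)"
    proof (rule inj_onI)
      fix g h assume "(g x, g(x := c)) = (h x, h(x := c))"
      then show "g = h"
        by (metis Pair_inject fun_upd_triv fun_upd_upd)
    qed
    show "(\<lambda>g. (g x, g(x := c))) ` order_maps X prec I \<subseteq> I \<times> ?A"
    proof (rule image_subsetI)
      fix g assume g: "g \<in> order_maps X prec I"
      have "g(x := c) \<in> order_maps X prec I"
        using \<open>x \<in> X\<close> min least order_mapsD[OF g] by (intro order_mapsI) auto
      then show "(g x, g(x := c)) \<in> I \<times> ?A"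
        using order_mapsD(1)[OF g \<open>x \<in> X\<close>] by simp
    qed
    show "finite (I \<times> ?A)"
      using assms by (simp add: finite_order_maps)
  qed
  then show ?thesis
    by (simp add: card_cartesian_product)
qed

section \<open>Exchanging two maps on link components\<close>

text \<open>
  The relation and the set exchanged are functions of the pointwise maximum \<open>q\<close> and minimum \<open>p\<close>,
  which makes the exchange an involution.
\<close>

definition links :: "'a set \<Rightarrow> ('a \<Rightarrow> 'a \<Rightarrow> bool) \<Rightarrow> ('a \<Rightarrow> nat) \<Rightarrow> ('a \<Rightarrow> nat) \<Rightarrow> ('a \<times> 'a) set" where
  "links X prec p q =
     {(x, y). x \<in> X \<and> y \<in> X \<and> (prec x y \<and> p y < q x \<or> prec y x \<and> p x < q y)}"

definition swap_set :: "'a set \<Rightarrow> ('a \<Rightarrow> 'a \<Rightarrow> bool) \<Rightarrow> nat \<Rightarrow> ('a \<Rightarrow> nat) \<Rightarrow> ('a \<Rightarrow> nat) \<Rightarrow> 'a set" where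
  "swap_set X prec m g h =
     (links X prec (\<lambda>x. min (g x) (h x)) (\<lambda>x. max (g x) (h x)))\<^sup>* `` {x \<in> X. max (g x) (h x) = m}"

definition swap_on :: "'a set \<Rightarrow> ('a \<Rightarrow> 'b) \<times> ('a \<Rightarrow> 'b) \<Rightarrow> ('a \<Rightarrow> 'b) \<times> ('a \<Rightarrow> 'b)" where
  "swap_on C = (\<lambda>(g, h). (\<lambda>x. if x \<in> C then h x else g x, \<lambda>x. if x \<in> C then g x else h x))"

lemma swap_on_swap_on: "swap_on C (swap_on C gh) = gh"
  by (cases gh) (auto simp: swap_on_def)

lemma swap_set_swap_on:
  assumes "swap_on C (g, h) = (g', h')"
  shows "swap_set X prec m g' h' = swap_set X prec m g h"
proof -
  have "min (g' x) (h' x) = min (g x) (h x)" "max (g' x) (h' x) = max (g x) (h x)" for x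
    using assms by (auto simp: swap_on_def min.commute max.commute)
  then show ?thesis
    by (simp add: swap_set_def)
qed

text \<open>The exchanged set can be read off from the resulting pair by
  \<open>swap_set_swap_on\<close>, and exchanging on it once more restores the original
  pair.\<close>

lemma inj_swap: "inj (\<lambda>(g, h). swap_on (swap_set X prec m g h) (g, h))"
proof (rule injI, clarify)
  fix g h k l
  assume eq: "swap_on (swap_set X prec m g h) (g, h) = swap_on (swap_set X prec m k l) (k, l)"
  obtain g' h' where gh': "swap_on (swap_set X prec m g h) (g, h) = (g', h')"
    by fastforce
  then have "swap_set X prec m g h = swap_set X prec m k l"
    using eq swap_set_swap_on by metis
  then have "(g, h) = (k, l)"
    using eq swap_on_swap_on by metis
  then show "g = k \<and> h = l"
    by simp
qed

text \<open>Monotonicity is in danger only for \<open>prec x y\<close> with exactly one of the two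
  points in \<open>C\<close>. As \<open>C\<close> is closed under links, such points are not linked,
  so both crossed inequalities \<open>g x \<le> h y\<close> and \<open>h x \<le> g y\<close>
  hold.\<close>

lemma swap_on_order_maps:
  fixes m :: nat
  assumes g: "g \<in> order_maps X prec UNIV" and h: "h \<in> order_maps X prec UNIV"
  defines "C \<equiv> swap_set X prec m g h"
  shows "fst (swap_on C (g, h)) \<in> order_maps X prec UNIV"
    and "snd (swap_on C (g, h)) \<in> order_maps X prec UNIV"
proof -
  let ?L = "links X prec (\<lambda>x. min (g x) (h x)) (\<lambda>x. max (g x) (h x))"
  have closed: "y \<in> C" if "x \<in> C" "(x, y) \<in> ?L" for x y
    using that unfolding C_def swap_set_def by (auto intro: rtrancl_into_rtrancl)
  have *: "x \<in> C \<longleftrightarrow> y \<in> C"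
    if "x \<in> X" "y \<in> X" "prec x y" "\<not> (g x \<le> h y \<and> h x \<le> g y)" for x y
  proof -
    have "min (g y) (h y) < max (g x) (h x)"
      using that(4) by linarith
    then show ?thesis
      using that(1-3) closed[of x y] closed[of y x] by (auto simp: links_def)
  qed
  show "fst (swap_on C (g, h)) \<in> order_maps X prec UNIV"
    "snd (swap_on C (g, h)) \<in> order_maps X prec UNIV"
    using * order_mapsD[OF g] order_mapsD[OF h]
    by (auto simp: swap_on_def intro!: order_mapsI) blast+
qed

text \<open>Induction along a path of links. It starts where the maximum is \<open>m\<close>, which
  \<open>h\<close> cannot reach, so \<open>g\<close> is larger there. A link from \<open>y\<close>
  to \<open>z\<close> keeps \<open>g\<close> on top: if \<open>prec y z\<close>, then
  \<open>min (g z) (h z) < g y \<le> g z\<close>; if \<open>prec z y\<close>, then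
  \<open>h z \<le> h y < max (g z) (h z)\<close>.\<close>

lemma swap_set_less:
  assumes g: "g \<in> order_maps X prec UNIV" and h: "h \<in> order_maps X prec {..<m}"
    and "x \<in> swap_set X prec m g h"
  shows "h x < g x" and "x \<in> X"
proof -
  let ?L = "links X prec (\<lambda>x. min (g x) (h x)) (\<lambda>x. max (g x) (h x))"
  obtain w where w: "w \<in> X" "max (g w) (h w) = m" "(w, x) \<in> ?L\<^sup>*"
    using assms(3) by (auto simp: swap_set_def)
  have "h x < g x \<and> x \<in> X"
    using w(3)
  proof induction
    case base
    then show ?case
      using w order_mapsD(1)[OF h, of w] by (auto simp: max_def split: if_splits)
  next
    case (step y z)
    then show ?case
      using order_mapsD(3)[OF g, of y z] order_mapsD(3)[OF h, of y z]
        order_mapsD(3)[OF g, of z y] order_mapsD(3)[OF h, of z y]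
      by (auto simp: links_def min_def max_def split: if_splits)
  qed
  then show "h x < g x" and "x \<in> X"
    by auto
qed

lemma order_maps_restrict_range:
  assumes "g \<in> order_maps X prec UNIV" and "\<And>x. x \<in> X \<Longrightarrow> g x \<in> I"
  shows "g \<in> order_maps X prec I"
  using assms by (auto simp: order_maps_def PiE_iff)

text \<open>The exchange at \<open>m = Suc b\<close> injects the pairs counted by the first product
  into those counted on the right, and it misses every pair counted by the second product.\<close>

lemma card_order_maps_mult_le:
  assumes "finite X" and "x \<in> X"
  shows "card (order_maps X prec {a..Suc b}) * card (order_maps X prec {Suc a..b}) +
      card {g \<in> order_maps X prec {a..b}. g x = a} *
      card {h \<in> order_maps X prec {Suc a..Suc b}. h x = Suc b}
    \<le> card (order_maps X prec {a..b}) * card (order_maps X prec {Suc a..Suc b})"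
proof -
  let ?S = "order_maps X prec {a..Suc b} \<times> order_maps X prec {Suc a..b}"
  let ?T = "order_maps X prec {a..b} \<times> order_maps X prec {Suc a..Suc b}"
  let ?U = "{g \<in> order_maps X prec {a..b}. g x = a} \<times>
    {h \<in> order_maps X prec {Suc a..Suc b}. h x = Suc b}"
  let ?f = "\<lambda>(g, h). swap_on (swap_set X prec (Suc b) g h) (g, h)"
  have image: "?f ` ?S \<subseteq> ?T - ?U"
  proof (rule image_subsetI)
    fix gh assume "gh \<in> ?S"
    then obtain g h where gh: "gh = (g, h)"
      and g: "g \<in> order_maps X prec {a..Suc b}" and h: "h \<in> order_maps X prec {Suc a..b}"
      by blast
    define C where "C = swap_set X prec (Suc b) g h"
    define g' where "g' = fst (swap_on C (g, h))"
    define h' where "h' = snd (swap_on C (g, h))"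
    have g0: "g \<in> order_maps X prec UNIV" and h0: "h \<in> order_maps X prec UNIV"
      using g h order_maps_mono[OF subset_UNIV] by blast+
    have "h \<in> order_maps X prec {..<Suc b}"
      by (rule subsetD[OF order_maps_mono h]) auto
    then have less: "h y < g y" if "y \<in> C" for y
      using swap_set_less(1)[OF g0] that by (auto simp: C_def)
    \<comment> \<open>As \<open>h \<le> b\<close>, the maximum is \<open>Suc b\<close> exactly where
      \<open>g\<close> is, so \<open>C\<close> contains all such points.\<close>
    have top: "g y \<noteq> Suc b" if "y \<in> X" "y \<notin> C" for y
      using that order_mapsD(1)[OF h, of y] by (auto simp: C_def swap_set_def)
    have bounds: "a \<le> g y" "g y \<le> Suc b" "Suc a \<le> h y" "h y \<le> b" if "y \<in> X" for y
      using order_mapsD(1)[OF g that] order_mapsD(1)[OF h that] by auto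
    have "g' \<in> order_maps X prec {a..b}"
    proof (rule order_maps_restrict_range)
      show "g' \<in> order_maps X prec UNIV"
        unfolding g'_def C_def by (rule swap_on_order_maps(1)[OF g0 h0])
      show "g' y \<in> {a..b}" if "y \<in> X" for y
        using top[OF that] bounds[OF that] by (auto simp: g'_def swap_on_def)
    qed
    moreover have "h' \<in> order_maps X prec {Suc a..Suc b}"
    proof (rule order_maps_restrict_range)
      show "h' \<in> order_maps X prec UNIV"
        unfolding h'_def C_def by (rule swap_on_order_maps(2)[OF g0 h0])
      show "h' y \<in> {Suc a..Suc b}" if "y \<in> X" for y
        using less[of y] bounds[OF that] by (auto simp: h'_def swap_on_def)
    qed
    \<comment> \<open>Outside \<open>C\<close>, \<open>h' x = h x \<le> b\<close>; inside
      \<open>C\<close>, \<open>g' x = h x \<ge> Suc a\<close>.\<close>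
    moreover have "\<not> (g' x = a \<and> h' x = Suc b)"
      using bounds[OF \<open>x \<in> X\<close>] by (auto simp: g'_def h'_def swap_on_def)
    ultimately have "(g', h') \<in> ?T - ?U"
      by blast
    moreover have "?f gh = (g', h')"
      by (simp add: gh g'_def h'_def C_def)
    ultimately show "?f gh \<in> ?T - ?U"
      by (simp only:)
  qed
  have fin: "finite ?T" and sub: "?U \<subseteq> ?T"
    using \<open>finite X\<close> by (auto simp: finite_order_maps)
  have "card ?S \<le> card (?T - ?U)"
    using fin by (intro card_inj_on_le[OF _ image] inj_on_subset[OF inj_swap]) auto
  also have "\<dots> = card ?T - card ?U"
    using fin sub by (intro card_Diff_subset) (auto intro: finite_subset)
  finally have "card ?S + card ?U \<le> card ?T"
    using card_mono[OF fin sub] by linarith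
  then show ?thesis
    by (simp add: card_cartesian_product)
qed

section \<open>The order polynomial and the final estimate\<close>

lemma order_poly_pos:
  assumes "finite X" and "t \<ge> 1"
  shows "order_poly X prec t \<ge> 1"
proof -
  have "(\<lambda>y\<in>X. 1) \<in> order_maps X prec {1..t}"
    using assms by (intro const_in_order_maps) auto
  then have "card (order_maps X prec {1..t}) \<noteq> 0"
    using finite_order_maps[OF \<open>finite X\<close>, of "{1..t}" prec] by auto
  then show ?thesis
    by (simp add: order_poly_eq_card_order_maps)
qed

lemma order_poly_mono:
  assumes "finite X" and "s \<le> t"
  shows "order_poly X prec s \<le> order_poly X prec t"
  unfolding order_poly_eq_card_order_maps
  by (intro card_mono finite_order_maps order_maps_mono) (use assms in auto)

lemma strict_poset_on_minimal:
  assumes "finite X" and "X \<noteq> {}" and "strict_poset_on X prec"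
  shows "\<exists>x\<in>X. \<forall>y\<in>X. \<not> prec y x"
proof -
  have irrefl: "irreflp_on X prec" and trans: "transp_on X prec"
    using assms(3) by (auto simp: strict_poset_on_def)
  then have "asymp_on X prec"
    by (simp add: asymp_on_iff_irreflp_on_if_transp_on)
  then obtain x where "x \<in> X" "\<forall>y\<in>X. y \<noteq> x \<longrightarrow> \<not> prec y x"
    using Finite_Set.bex_min_element[OF \<open>finite X\<close> _ trans \<open>X \<noteq> {}\<close>] by blast
  then have "\<not> prec y x" if "y \<in> X" for y
    using that irreflp_onD[OF irrefl] by (cases "y = x") auto
  with \<open>x \<in> X\<close> show ?thesis
    by blast
qed

text \<open>The missed pairs number \<open>A * B\<close>, where \<open>A\<close> counts the maps
  with value 1 at a minimal point and \<open>B\<close> those with value \<open>t + 1\<close> there.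
  Bounding \<open>B\<close> below by 1 leaves \<open>A\<close>.\<close>

lemma order_poly_gap:
  assumes "finite X" and "X \<noteq> {}" and "strict_poset_on X prec" and "t \<ge> 2"
  obtains A where "order_poly X prec (t + 1) * order_poly X prec (t - 1) + A \<le> (order_poly X prec t)\<^sup>2"
    and "order_poly X prec t \<le> t * A"
proof -
  let ?\<Omega> = "order_poly X prec"
  obtain x where "x \<in> X" and minimal: "\<forall>y\<in>X. \<not> prec y x"
    using strict_poset_on_minimal[OF assms(1-3)] by blast
  define A where "A = card {g \<in> order_maps X prec {1..t}. g x = 1}"
  define B where "B = card {h \<in> order_maps X prec {Suc 1..Suc t}. h x = Suc t}"
  \<comment> \<open>The constant map with the top value witnesses \<open>B \<ge> 1\<close>.\<close>
  have "(\<lambda>y\<in>X. Suc t) \<in> {h \<in> order_maps X prec {Suc 1..Suc t}. h x = Suc t}"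
    using \<open>x \<in> X\<close> assms(4) by (auto intro!: const_in_order_maps)
  moreover have "finite {h \<in> order_maps X prec {Suc 1..Suc t}. h x = Suc t}"
    using assms(1) by (simp add: finite_order_maps)
  ultimately have "B \<noteq> 0"
    unfolding B_def using card_0_eq by blast
  have shift: "card (order_maps X prec {Suc 1..t}) = ?\<Omega> (t - 1)"
    using card_order_maps_Suc[of X prec 1 "t - 1"] assms(4)
    by (simp add: order_poly_eq_card_order_maps)
  have "?\<Omega> (t + 1) * ?\<Omega> (t - 1) + A * B \<le> (?\<Omega> t)\<^sup>2"
    using card_order_maps_mult_le[OF \<open>finite X\<close> \<open>x \<in> X\<close>, of prec 1 t]
    unfolding shift card_order_maps_Suc A_def[symmetric] B_def[symmetric]
    by (simp add: order_poly_eq_card_order_maps power2_eq_square)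
  moreover have "A \<le> A * B"
    using \<open>B \<noteq> 0\<close> by simp
  ultimately have "?\<Omega> (t + 1) * ?\<Omega> (t - 1) + A \<le> (?\<Omega> t)\<^sup>2"
    by linarith
  moreover have "?\<Omega> t \<le> t * A"
    using card_order_maps_le_minimal[where prec = prec and I = "{1..t}" and c = 1,
        OF \<open>finite X\<close> _ \<open>x \<in> X\<close> minimal[rule_format]] assms(4)
    by (simp add: order_poly_eq_card_order_maps A_def)
  ultimately show ?thesis
    by (rule that)
qed

theorem theorem4p8:
  fixes X :: "'a set" and prec :: "'a \<Rightarrow> 'a \<Rightarrow> bool" and n t :: nat
  assumes "finite X" and "strict_poset_on X prec"
    and "card X = n" and "n \<ge> 1"
    and "t \<ge> 2"
  shows "(real (order_poly X prec t))\<^sup>2 \<ge>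
           (1 + 1 / (real t + 1) ^ (n + 1)) *
             real (order_poly X prec (t + 1)) * real (order_poly X prec (t - 1))
       \<and> (order_poly X prec t)\<^sup>2 > order_poly X prec (t + 1) * order_poly X prec (t - 1)"
proof -
  let ?\<Omega> = "order_poly X prec"
  have "X \<noteq> {}"
    using assms by auto
  then obtain A where gap: "?\<Omega> (t + 1) * ?\<Omega> (t - 1) + A \<le> (?\<Omega> t)\<^sup>2" and "?\<Omega> t \<le> t * A"
    using order_poly_gap[OF \<open>finite X\<close> _ \<open>strict_poset_on X prec\<close> \<open>t \<ge> 2\<close>] by blast
  have "A \<noteq> 0"
    using \<open>?\<Omega> t \<le> t * A\<close> order_poly_pos[OF \<open>finite X\<close>, of t prec] assms(5) by (cases A) auto
  \<comment> \<open>Weakening \<open>t\<close> to \<open>t + 1\<close> makes this factor combine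
    with \<open>(t + 1) ^ n\<close> from the count of all maps; hence the exponent
    \<open>n + 1\<close>.\<close>
  have lower: "?\<Omega> (t - 1) \<le> (t + 1) * A"
    using \<open>?\<Omega> t \<le> t * A\<close> order_poly_mono[OF \<open>finite X\<close>, of "t - 1" t prec] by simp
  have upper: "?\<Omega> (t + 1) \<le> (t + 1) ^ n"
    using card_order_maps_le[OF \<open>finite X\<close>, of "{1..t + 1}" prec] assms(3)
    by (simp add: order_poly_eq_card_order_maps)
  have "?\<Omega> (t + 1) * ?\<Omega> (t - 1) \<le> (t + 1) ^ n * ((t + 1) * A)"
    by (rule mult_le_mono[OF upper lower])
  then have "?\<Omega> (t + 1) * ?\<Omega> (t - 1) \<le> A * (t + 1) ^ (n + 1)"
    by (simp only: power_add power_one_right ac_simps)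
  then have "real (?\<Omega> (t + 1)) * real (?\<Omega> (t - 1)) \<le> real A * (real t + 1) ^ (n + 1)"
    by (simp only: of_nat_1 of_nat_add of_nat_mult of_nat_power flip: of_nat_le_iff[where 'a = real])
  \<comment> \<open>The extra term of the claim is at most \<open>A\<close>, which the gap
    inequality absorbs.\<close>
  then have "real (?\<Omega> (t + 1)) * real (?\<Omega> (t - 1)) / (real t + 1) ^ (n + 1) \<le> real A"
    by (subst pos_divide_le_eq) auto
  moreover have "real (?\<Omega> (t + 1)) * real (?\<Omega> (t - 1)) + real A \<le> (real (?\<Omega> t))\<^sup>2"
    using gap by (simp only: of_nat_add of_nat_mult of_nat_power flip: of_nat_le_iff[where 'a = real])
  ultimately have "(1 + 1 / (real t + 1) ^ (n + 1)) * real (?\<Omega> (t + 1)) * real (?\<Omega> (t - 1))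
      \<le> (real (?\<Omega> t))\<^sup>2"
    by (simp add: distrib_right)
  moreover have "?\<Omega> (t + 1) * ?\<Omega> (t - 1) < (?\<Omega> t)\<^sup>2"
    using gap \<open>A \<noteq> 0\<close> by linarith
  ultimately show ?thesis ..
qed

end
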